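(* Let $L$ be a finite-dimensional Lie algebra over an arbitrary field $F$. Then: (i) $\gamma(L)$ is nil on $L$ (that is, $\mathrm{ad}_L\,x$ is nilpotent for every $x \in \gamma(L)$), and so $\gamma(L)$ is nilpotent; (ii) $L$ is nilpotent if and only if $L = \gamma(L)$; (iii) $L$ is nilpotent if and only if $\mathcal{G}_L = \emptyset$; (iv) $L$ is nilpotent if and only if $M$ is an ideal of $L$ for all $M \in \mathcal{G}_L$; and (v) $L$ is nilpotent if and only if $L/B$ is nilpotent for some ideal $B$ of $L$ with $B \subseteq \gamma(L)$.
   Context: For $x \in L$, the Engel subalgebra $E_L(x)$ is the Fitting null-component of $L$ relative to $\mathrm{ad}\,x$, i.e. $E_L(x) = \{y \in L : (\mathrm{ad}\,x)^n(y) = 0 \text{ for some } n\}$. For a subalgebra $U$ of $L$, the core $U_L$ is the largest ideal of $L$ contained in $U$. Let $\mathcal{G}_L$ be the set of all maximal subalgebras $M$ of $L$ such that $E_L(x) \subseteq M$ for some $x \in L$. Put $G(L) = \bigcap_{M \in \mathcal{G}_L} M$ if $\mathcal{G}_L \neq \emptyset$ and $G(L) = L$ otherwise, and $\gamma(L) = G(L)_L$. *)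

theory Defs
  imports "Jordan_Normal_Form.Missing_VectorSpace" "HOL-Algebra.QuotRing"
begin

text \<open>As for \<^locale>\<open>algebra\<close> in HOL-Algebra, the product of the algebra, here the Lie bracket
  $[x,y]$, is the field \<^const>\<open>mult\<close> of the module record. The field \<^const>\<open>one\<close> of \<open>L\<close> is not used.\<close>

locale lie_algebra = vectorspace F L
  for F :: "('a, 'm) ring_scheme" (structure)
    and L :: "('a, 'b, 'n) module_scheme" (structure) +
  assumes bracket_closed:
      "\<lbrakk>x \<in> carrier L; y \<in> carrier L\<rbrakk> \<Longrightarrow> x \<otimes>\<^bsub>L\<^esub> y \<in> carrier L"
    and bracket_add_left:
      "\<lbrakk>x \<in> carrier L; y \<in> carrier L; z \<in> carrier L\<rbrakk>
        \<Longrightarrow> (x \<oplus>\<^bsub>L\<^esub> y) \<otimes>\<^bsub>L\<^esub> z = (x \<otimes>\<^bsub>L\<^esub> z) \<oplus>\<^bsub>L\<^esub> (y \<otimes>\<^bsub>L\<^esub> z)"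
    and bracket_add_right:
      "\<lbrakk>x \<in> carrier L; y \<in> carrier L; z \<in> carrier L\<rbrakk>
        \<Longrightarrow> x \<otimes>\<^bsub>L\<^esub> (y \<oplus>\<^bsub>L\<^esub> z) = (x \<otimes>\<^bsub>L\<^esub> y) \<oplus>\<^bsub>L\<^esub> (x \<otimes>\<^bsub>L\<^esub> z)"
    and bracket_smult_left:
      "\<lbrakk>a \<in> carrier F; x \<in> carrier L; y \<in> carrier L\<rbrakk>
        \<Longrightarrow> (a \<odot>\<^bsub>L\<^esub> x) \<otimes>\<^bsub>L\<^esub> y = a \<odot>\<^bsub>L\<^esub> (x \<otimes>\<^bsub>L\<^esub> y)"
    and bracket_smult_right:
      "\<lbrakk>a \<in> carrier F; x \<in> carrier L; y \<in> carrier L\<rbrakk>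
        \<Longrightarrow> x \<otimes>\<^bsub>L\<^esub> (a \<odot>\<^bsub>L\<^esub> y) = a \<odot>\<^bsub>L\<^esub> (x \<otimes>\<^bsub>L\<^esub> y)"
    and bracket_self:
      "x \<in> carrier L \<Longrightarrow> x \<otimes>\<^bsub>L\<^esub> x = \<zero>\<^bsub>L\<^esub>"
    and jacobi:
      "\<lbrakk>x \<in> carrier L; y \<in> carrier L; z \<in> carrier L\<rbrakk>
        \<Longrightarrow> (x \<otimes>\<^bsub>L\<^esub> (y \<otimes>\<^bsub>L\<^esub> z)) \<oplus>\<^bsub>L\<^esub> (y \<otimes>\<^bsub>L\<^esub> (z \<otimes>\<^bsub>L\<^esub> x)) \<oplus>\<^bsub>L\<^esub> (z \<otimes>\<^bsub>L\<^esub> (x \<otimes>\<^bsub>L\<^esub> y)) = \<zero>\<^bsub>L\<^esub>"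

definition lie_subalgebra ::
    "('a, 'm) ring_scheme \<Rightarrow> 'b set \<Rightarrow> ('a, 'b, 'n) module_scheme \<Rightarrow> bool" where
  "lie_subalgebra F U L \<longleftrightarrow> subspace F U L \<and> (\<forall>x\<in>U. \<forall>y\<in>U. x \<otimes>\<^bsub>L\<^esub> y \<in> U)"

definition lie_ideal ::
    "('a, 'm) ring_scheme \<Rightarrow> 'b set \<Rightarrow> ('a, 'b, 'n) module_scheme \<Rightarrow> bool" where
  "lie_ideal F I L \<longleftrightarrow> subspace F I L \<and> (\<forall>x\<in>I. \<forall>y\<in>carrier L. x \<otimes>\<^bsub>L\<^esub> y \<in> I)"

definition maximal_lie_subalgebra ::
    "('a, 'm) ring_scheme \<Rightarrow> 'b set \<Rightarrow> ('a, 'b, 'n) module_scheme \<Rightarrow> bool" where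
  "maximal_lie_subalgebra F M L \<longleftrightarrow>
     lie_subalgebra F M L \<and> M \<noteq> carrier L \<and>
     (\<forall>U. lie_subalgebra F U L \<and> M \<subseteq> U \<and> U \<noteq> carrier L \<longrightarrow> U = M)"

text \<open>For an ideal \<open>B\<close>, scalars act by \<open>a \<odot> (B +> x) = B +> (a \<odot> x)\<close>; the union over representatives
  follows \<^const>\<open>rcoset_mult\<close> and also gives the right value for \<open>a = \<zero>\<close>.\<close>

definition lie_quotient :: "('a, 'b, 'n) module_scheme \<Rightarrow> 'b set \<Rightarrow> ('a, 'b set) module" where
  "lie_quotient L B =
     \<lparr>carrier = a_rcosets\<^bsub>L\<^esub> B, mult = rcoset_mult L B, one = B +>\<^bsub>L\<^esub> \<one>\<^bsub>L\<^esub>,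
      zero = B, add = set_add L, smult = (\<lambda>a X. \<Union>x\<in>X. B +>\<^bsub>L\<^esub> (a \<odot>\<^bsub>L\<^esub> x))\<rparr>"

primrec lower_central_series ::
    "('a, 'm) ring_scheme \<Rightarrow> ('a, 'b, 'n) module_scheme \<Rightarrow> nat \<Rightarrow> 'b set" where
  "lower_central_series F L 0 = carrier L"
| "lower_central_series F L (Suc n) =
     module.span F L {x \<otimes>\<^bsub>L\<^esub> y | x y. x \<in> lower_central_series F L n \<and> y \<in> carrier L}"

definition lie_nilpotent :: "('a, 'm) ring_scheme \<Rightarrow> ('a, 'b, 'n) module_scheme \<Rightarrow> bool" where
  "lie_nilpotent F L \<longleftrightarrow> (\<exists>n. lower_central_series F L n = {\<zero>\<^bsub>L\<^esub>})"

definition lie_ad :: "('a, 'b, 'n) module_scheme \<Rightarrow> 'b \<Rightarrow> 'b \<Rightarrow> 'b" where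
  "lie_ad L x y = x \<otimes>\<^bsub>L\<^esub> y"

definition nil_on :: "'b set \<Rightarrow> ('a, 'b, 'n) module_scheme \<Rightarrow> bool" where
  "nil_on S L \<longleftrightarrow> (\<forall>x\<in>S. \<exists>n. \<forall>y\<in>carrier L. (lie_ad L x ^^ n) y = \<zero>\<^bsub>L\<^esub>)"

definition engel_subalgebra :: "('a, 'b, 'n) module_scheme \<Rightarrow> 'b \<Rightarrow> 'b set" where
  "engel_subalgebra L x = {y \<in> carrier L. \<exists>n. (lie_ad L x ^^ n) y = \<zero>\<^bsub>L\<^esub>}"

text \<open>The order on sets is inclusion, so \<^const>\<open>Greatest\<close> yields the largest ideal inside \<open>U\<close>; it
  exists whenever \<open>U\<close> is a subspace, being the sum of all ideals contained in \<open>U\<close>.\<close>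

definition lie_core ::
    "('a, 'm) ring_scheme \<Rightarrow> 'b set \<Rightarrow> ('a, 'b, 'n) module_scheme \<Rightarrow> 'b set" where
  "lie_core F U L = (GREATEST I. lie_ideal F I L \<and> I \<subseteq> U)"

definition engel_maximal_set ::
    "('a, 'm) ring_scheme \<Rightarrow> ('a, 'b, 'n) module_scheme \<Rightarrow> 'b set set" where
  "engel_maximal_set F L =
     {M. maximal_lie_subalgebra F M L \<and> (\<exists>x\<in>carrier L. engel_subalgebra L x \<subseteq> M)}"

definition engel_frattini ::
    "('a, 'm) ring_scheme \<Rightarrow> ('a, 'b, 'n) module_scheme \<Rightarrow> 'b set" where
  "engel_frattini F L =
     (if engel_maximal_set F L \<noteq> {} then \<Inter>(engel_maximal_set F L) else carrier L)"

definition engel_frattini_core ::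
    "('a, 'm) ring_scheme \<Rightarrow> ('a, 'b, 'n) module_scheme \<Rightarrow> 'b set" where
  "engel_frattini_core F L = lie_core F (engel_frattini F L) L"

end

theory Submission
  imports Defs
begin

text \<open>Two facts carry the proof. The first is the Fitting decomposition: \<open>L\<close> is the sum of the Engel
  subalgebra of \<open>x\<close> and the image of any power of \<open>ad x\<close>
  (lemma \<open>engel_subalgebra_supplement\<close>). Hence a proper subalgebra that contains the Engel subalgebra
  of \<open>x\<close> never contains the image of a power of \<open>ad x\<close>. The second is Engel's theorem
  (theorem \<open>engel\<close>): \<open>L\<close> is nilpotent as soon as the Engel subalgebra of each \<open>x\<close> is all of \<open>L\<close>,
  that is, as soon as each \<open>ad x\<close> is nilpotent.

  If the Engel subalgebra of \<open>x\<close> is proper, it lies in a maximal subalgebra, which then belongs to the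
  family defining \<open>G(L)\<close>. So the family is empty exactly when \<open>L\<close> is nilpotent. No ideal can be a member:
  an ideal that contains the Engel subalgebra of \<open>x\<close> contains \<open>x\<close>, hence the image of \<open>ad x\<close>.
  The other parts use one argument (lemma \<open>engel_subalgebra_full\<close>): if some power of \<open>ad x\<close> maps \<open>L\<close>
  into \<open>G(L)\<close>, then \<open>ad x\<close> is nilpotent, since each member of the family
  contains this image. For \<open>x\<close> in the ideal \<open>\<gamma>(L)\<close> the first power of \<open>ad x\<close> does so. If \<open>L / B\<close> is
  nilpotent with \<open>B\<close> inside \<open>\<gamma>(L)\<close>, then a high power of \<open>ad x\<close> does so for each \<open>x\<close>.\<close>

section \<open>Subspaces of a finite-dimensional vector space\<close>

context vectorspace
begin

lemma subspace_iff:
  "subspace K W V \<longleftrightarrow>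
     W \<subseteq> carrier V \<and> \<zero>\<^bsub>V\<^esub> \<in> W \<and> (\<forall>v\<in>W. \<forall>w\<in>W. v \<oplus>\<^bsub>V\<^esub> w \<in> W) \<and>
     (\<forall>c\<in>carrier K. \<forall>v\<in>W. c \<odot>\<^bsub>V\<^esub> v \<in> W)"
  using module_axioms vectorspace_axioms by (auto simp: subspace_def submodule_def)

lemma subspaceI:
  assumes "W \<subseteq> carrier V" "\<zero>\<^bsub>V\<^esub> \<in> W" "\<And>v w. v \<in> W \<Longrightarrow> w \<in> W \<Longrightarrow> v \<oplus>\<^bsub>V\<^esub> w \<in> W"
    "\<And>c v. c \<in> carrier K \<Longrightarrow> v \<in> W \<Longrightarrow> c \<odot>\<^bsub>V\<^esub> v \<in> W"
  shows "subspace K W V"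
  using assms by (simp add: subspace_iff)

lemma subspaceD:
  assumes "subspace K W V"
  shows subspace_subset: "W \<subseteq> carrier V"
    and subspace_carrier: "v \<in> W \<Longrightarrow> v \<in> carrier V"
    and subspace_zero: "\<zero>\<^bsub>V\<^esub> \<in> W"
    and subspace_add: "v \<in> W \<Longrightarrow> w \<in> W \<Longrightarrow> v \<oplus>\<^bsub>V\<^esub> w \<in> W"
    and subspace_smult: "c \<in> carrier K \<Longrightarrow> v \<in> W \<Longrightarrow> c \<odot>\<^bsub>V\<^esub> v \<in> W"
  using assms by (auto simp: subspace_iff)

lemma subspace_uminus:
  assumes "subspace K W V" "v \<in> W"
  shows "\<ominus>\<^bsub>V\<^esub> v \<in> W"
  using subspace_smult[OF assms(1) _ assms(2), of "\<ominus>\<^bsub>K\<^esub> \<one>\<^bsub>K\<^esub>"] subspace_carrier[OF assms]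
  by (simp add: smult_minus_1)

lemma subspace_whole: "subspace K (carrier V) V"
  by (rule subspaceI) auto

lemma subspace_trivial: "subspace K {\<zero>\<^bsub>V\<^esub>} V"
  by (rule subspaceI) auto

lemma subspace_Inter:
  assumes "\<M> \<noteq> {}" "\<And>W. W \<in> \<M> \<Longrightarrow> subspace K W V"
  shows "subspace K (\<Inter>\<M>) V"
proof (rule subspaceI)
  show "\<Inter>\<M> \<subseteq> carrier V"
    using assms subspace_subset by blast
qed (use subspaceD(3-5)[OF assms(2)] in auto)

definition adjoin :: "'c set \<Rightarrow> 'c \<Rightarrow> 'c set" where
  "adjoin W v = {w \<oplus>\<^bsub>V\<^esub> c \<odot>\<^bsub>V\<^esub> v | w c. w \<in> W \<and> c \<in> carrier K}"

lemma adjoin_subspace: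
  assumes W: "subspace K W V" and v: "v \<in> carrier V"
  shows "subspace K (adjoin W v) V"
proof (rule subspaceI)
  note WD = subspaceD[OF W]
  show "adjoin W v \<subseteq> carrier V"
    using WD(1) v by (auto simp: adjoin_def)
  show "\<zero>\<^bsub>V\<^esub> \<in> adjoin W v"
    unfolding adjoin_def using WD(3) v
    by (intro CollectI exI[of _ "\<zero>\<^bsub>V\<^esub>"] exI[of _ "\<zero>\<^bsub>K\<^esub>"]) simp
  fix x y assume "x \<in> adjoin W v" "y \<in> adjoin W v"
  then obtain w c w' c' where *: "w \<in> W" "c \<in> carrier K" "x = w \<oplus>\<^bsub>V\<^esub> c \<odot>\<^bsub>V\<^esub> v"
    "w' \<in> W" "c' \<in> carrier K" "y = w' \<oplus>\<^bsub>V\<^esub> c' \<odot>\<^bsub>V\<^esub> v"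
    by (auto simp: adjoin_def)
  then have "x \<oplus>\<^bsub>V\<^esub> y = (w \<oplus>\<^bsub>V\<^esub> w') \<oplus>\<^bsub>V\<^esub> (c \<oplus>\<^bsub>K\<^esub> c') \<odot>\<^bsub>V\<^esub> v"
    using WD(2) v by (simp add: smult_l_distr M.add.m_ac)
  then show "x \<oplus>\<^bsub>V\<^esub> y \<in> adjoin W v"
    using * WD(4) unfolding adjoin_def by blast
next
  note WD = subspaceD[OF W]
  fix c x assume c: "c \<in> carrier K" and "x \<in> adjoin W v"
  then obtain w c' where *: "w \<in> W" "c' \<in> carrier K" "x = w \<oplus>\<^bsub>V\<^esub> c' \<odot>\<^bsub>V\<^esub> v"
    by (auto simp: adjoin_def)
  then have "c \<odot>\<^bsub>V\<^esub> x = c \<odot>\<^bsub>V\<^esub> w \<oplus>\<^bsub>V\<^esub> (c \<otimes>\<^bsub>K\<^esub> c') \<odot>\<^bsub>V\<^esub> v"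
    using WD(2) v c by (simp add: smult_r_distr smult_assoc1)
  then show "c \<odot>\<^bsub>V\<^esub> x \<in> adjoin W v"
    using * c WD(5) unfolding adjoin_def by blast
qed

lemma adjoin_superset:
  assumes "subspace K W V" "v \<in> carrier V"
  shows "W \<subseteq> adjoin W v"
proof
  fix w assume "w \<in> W"
  then show "w \<in> adjoin W v"
    unfolding adjoin_def using subspace_carrier[OF assms(1)] assms(2)
    by (intro CollectI exI[of _ w] exI[of _ "\<zero>\<^bsub>K\<^esub>"]) simp
qed

lemma adjoin_mem:
  assumes "subspace K W V" "v \<in> carrier V"
  shows "v \<in> adjoin W v"
  unfolding adjoin_def using subspace_zero[OF assms(1)] assms(2)
  by (intro CollectI exI[of _ "\<zero>\<^bsub>V\<^esub>"] exI[of _ "\<one>\<^bsub>K\<^esub>"]) simp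

lemma adjoin_least:
  assumes "subspace K U V" "W \<subseteq> U" "v \<in> U"
  shows "adjoin W v \<subseteq> U"
  using assms subspaceD[OF assms(1)] by (auto simp: adjoin_def)

text \<open>Sizes of independent sets are taken in the ambient space, so that subspaces can be compared without
  making each of them a vector space of its own.\<close>

definition rank :: "'c set \<Rightarrow> nat" where
  "rank W = Max (card ` {A. A \<subseteq> W \<and> lin_indpt A})"

lemma lin_indpt_empty: "lin_indpt {}"
  by (auto simp: lin_dep_def)

lemma card_indpt_le_dim:
  assumes "fin_dim" "W \<subseteq> carrier V" "n \<in> card ` {A. A \<subseteq> W \<and> lin_indpt A}"
  shows "n \<le> dim"
proof -
  obtain A where A: "n = card A" "A \<subseteq> W" "lin_indpt A"
    using assms(3) by blast
  then show ?thesis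
    using li_le_dim(2)[OF assms(1) subset_trans[OF A(2) assms(2)] A(3)] by simp
qed

lemma finite_indpt_cards:
  assumes "fin_dim" "W \<subseteq> carrier V"
  shows "finite (card ` {A. A \<subseteq> W \<and> lin_indpt A})"
proof (rule finite_subset)
  show "card ` {A. A \<subseteq> W \<and> lin_indpt A} \<subseteq> {..dim}"
    using card_indpt_le_dim[OF assms] by blast
qed simp

lemma indpt_cards_nonempty: "card ` {A. A \<subseteq> W \<and> lin_indpt A} \<noteq> {}"
  using lin_indpt_empty by blast

lemma rank_le_dim:
  assumes "fin_dim" "W \<subseteq> carrier V"
  shows "rank W \<le> dim"
  unfolding rank_def
  by (rule card_indpt_le_dim[OF assms Max_in[OF finite_indpt_cards[OF assms] indpt_cards_nonempty]])

lemma rank_attained: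
  assumes "fin_dim" "W \<subseteq> carrier V"
  obtains A where "A \<subseteq> W" "lin_indpt A" "finite A" "card A = rank W"
proof -
  have "rank W \<in> card ` {A. A \<subseteq> W \<and> lin_indpt A}"
    unfolding rank_def by (rule Max_in[OF finite_indpt_cards[OF assms] indpt_cards_nonempty])
  then obtain A where A: "A \<subseteq> W" "lin_indpt A" "card A = rank W"
    by force
  moreover have "finite A"
    using fin_dim_li_fin[OF assms(1) A(2)] A(1) assms(2) by blast
  ultimately show thesis using that by blast
qed

lemma card_le_rank:
  assumes "fin_dim" "W \<subseteq> carrier V" "A \<subseteq> W" "lin_indpt A"
  shows "card A \<le> rank W"
  unfolding rank_def
  by (rule Max_ge[OF finite_indpt_cards[OF assms(1,2)]]) (use assms(3,4) in blast)

text \<open>A vector outside the span of an independent set can be added to it, so an independent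
  subset of \<open>U\<close> of the largest size becomes larger by any vector of \<open>W - U\<close>.\<close>

lemma rank_strict_mono:
  assumes fd: "fin_dim" and U: "subspace K U V" and W: "subspace K W V" and sub: "U \<subset> W"
  shows "rank U < rank W"
proof -
  obtain A where A: "A \<subseteq> U" "lin_indpt A" "finite A" "card A = rank U"
    using rank_attained[OF fd subspace_subset[OF U]] by blast
  obtain w where w: "w \<in> W" "w \<notin> U"
    using sub by blast
  have "span A \<subseteq> U"
    using span_is_subset[OF A(1)] U by simp
  then have "w \<notin> span A" "w \<notin> A"
    using w A(1) by auto
  then have "lin_indpt (A \<union> {w})"
    using lin_dep_iff_in_span[of A w] A subspace_subset[OF U] subspace_subset[OF W] w by blast
  moreover have "A \<union> {w} \<subseteq> W"
    using A(1) sub w by blast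
  ultimately have "card (A \<union> {w}) \<le> rank W"
    by (intro card_le_rank[OF fd subspace_subset[OF W]])
  then show ?thesis
    using A \<open>w \<notin> A\<close> by simp
qed

text \<open>An independent subset of \<open>W\<close> of the largest size is a finite generating set of \<open>W\<close>: its span has
  the same rank as \<open>W\<close>, so it cannot be a proper subspace.\<close>

lemma subspace_fin_dim:
  assumes fd: "fin_dim" and W: "subspace K W V"
  shows "vectorspace.fin_dim K (vs W)"
proof -
  obtain A where A: "A \<subseteq> W" "lin_indpt A" "finite A" "card A = rank W"
    using rank_attained[OF fd subspace_subset[OF W]] by blast
  have sp: "subspace K (span A) V"
    using span_is_subspace A(1) subspace_subset[OF W] by blast
  have "span A \<subseteq> W"
    using span_is_subset[OF A(1)] W by simp
  moreover have "A \<subseteq> span A"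
    using in_own_span A(1) subspace_subset[OF W] by blast
  then have "rank W \<le> rank (span A)"
    using card_le_rank[OF fd subspace_subset[OF sp] _ A(2)] A(4) by simp
  ultimately have "span A = W"
    using rank_strict_mono[OF fd sp W] by (metis leD psubsetI)
  then have "LinearCombinations.module.span K (vs W) A = W"
    using span_li_not_depend[OF A(1)] W by simp
  then show ?thesis
    using vectorspace.fin_dim_def[OF subspace_is_vs[OF W]] A by auto
qed

lemma maximal_subspace_exists:
  assumes fd: "fin_dim" and P: "\<And>W. P W \<Longrightarrow> subspace K W V" and "P U"
  shows "\<exists>M. P M \<and> U \<subseteq> M \<and> (\<forall>W. P W \<and> M \<subseteq> W \<longrightarrow> W = M)"
proof -
  have "\<forall>W. P W \<and> U \<subseteq> W \<longrightarrow> rank W < Suc dim"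
    using rank_le_dim[OF fd subspace_subset] P by (auto simp: less_Suc_eq_le)
  then obtain M where M: "P M" "U \<subseteq> M" "\<forall>W. P W \<and> U \<subseteq> W \<longrightarrow> rank W \<le> rank M"
    using ex_has_greatest_nat[of "\<lambda>W. P W \<and> U \<subseteq> W" U rank "Suc dim"] \<open>P U\<close> by blast
  show ?thesis
  proof (intro exI conjI allI impI)
    fix W assume W: "P W \<and> M \<subseteq> W"
    then have "rank W \<le> rank M" using M by blast
    then show "W = M"
      using rank_strict_mono[OF fd P[OF M(1)] P] W by (metis leD psubsetI)
  qed (rule M)+
qed

lemma decreasing_subspaces_stabilise:
  assumes fd: "fin_dim" and W: "\<And>n. subspace K (W n) V" and dec: "\<And>n. W (Suc n) \<subseteq> W n"
  obtains n where "W (Suc n) = W n"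
proof (rule ccontr)
  assume "\<not> thesis"
  then have "W (Suc n) \<noteq> W n" for n
    using that by metis
  then have less: "rank (W (Suc n)) < rank (W n)" for n
    using dec by (intro rank_strict_mono[OF fd W W]) (simp add: psubset_eq)
  have "rank (W n) + n \<le> rank (W 0)" for n
  proof (induction n)
    case (Suc n)
    then show ?case using less[of n] by simp
  qed simp
  from this[of "Suc (rank (W 0))"] show False
    by simp
qed

end

section \<open>Brackets, adjoint maps and Engel subalgebras\<close>

context lie_algebra
begin

lemma bracket_zero_left: "x \<in> carrier L \<Longrightarrow> \<zero>\<^bsub>L\<^esub> \<otimes>\<^bsub>L\<^esub> x = \<zero>\<^bsub>L\<^esub>"
  using bracket_smult_left[of "\<zero>\<^bsub>F\<^esub>" "\<zero>\<^bsub>L\<^esub>" x] by (simp add: bracket_closed)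

lemma bracket_zero_right: "x \<in> carrier L \<Longrightarrow> x \<otimes>\<^bsub>L\<^esub> \<zero>\<^bsub>L\<^esub> = \<zero>\<^bsub>L\<^esub>"
  using bracket_smult_right[of "\<zero>\<^bsub>F\<^esub>" x "\<zero>\<^bsub>L\<^esub>"] by (simp add: bracket_closed)

lemma bracket_uminus_right:
  assumes "x \<in> carrier L" "y \<in> carrier L"
  shows "x \<otimes>\<^bsub>L\<^esub> (\<ominus>\<^bsub>L\<^esub> y) = \<ominus>\<^bsub>L\<^esub> (x \<otimes>\<^bsub>L\<^esub> y)"
  using bracket_smult_right[of "\<ominus>\<^bsub>F\<^esub> \<one>\<^bsub>F\<^esub>" x y] assms
  by (simp add: smult_minus_1 bracket_closed)

lemma bracket_anticommute:
  assumes "x \<in> carrier L" "y \<in> carrier L"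
  shows "x \<otimes>\<^bsub>L\<^esub> y = \<ominus>\<^bsub>L\<^esub> (y \<otimes>\<^bsub>L\<^esub> x)"
proof -
  have "(x \<oplus>\<^bsub>L\<^esub> y) \<otimes>\<^bsub>L\<^esub> (x \<oplus>\<^bsub>L\<^esub> y) = x \<otimes>\<^bsub>L\<^esub> (x \<oplus>\<^bsub>L\<^esub> y) \<oplus>\<^bsub>L\<^esub> y \<otimes>\<^bsub>L\<^esub> (x \<oplus>\<^bsub>L\<^esub> y)"
    using assms by (intro bracket_add_left) auto
  also have "\<dots> = x \<otimes>\<^bsub>L\<^esub> y \<oplus>\<^bsub>L\<^esub> y \<otimes>\<^bsub>L\<^esub> x"
    using assms by (simp add: bracket_add_right bracket_self bracket_closed)
  finally have "x \<otimes>\<^bsub>L\<^esub> y \<oplus>\<^bsub>L\<^esub> y \<otimes>\<^bsub>L\<^esub> x = \<zero>\<^bsub>L\<^esub>"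
    using assms by (simp add: bracket_self)
  then show ?thesis
    using assms by (simp add: M.minus_equality bracket_closed)
qed

lemma bracket_leibniz:
  assumes x: "x \<in> carrier L" and y: "y \<in> carrier L" and z: "z \<in> carrier L"
  shows "x \<otimes>\<^bsub>L\<^esub> (y \<otimes>\<^bsub>L\<^esub> z) = (x \<otimes>\<^bsub>L\<^esub> y) \<otimes>\<^bsub>L\<^esub> z \<oplus>\<^bsub>L\<^esub> y \<otimes>\<^bsub>L\<^esub> (x \<otimes>\<^bsub>L\<^esub> z)"
proof -
  note c = bracket_closed x y z
  have 1: "y \<otimes>\<^bsub>L\<^esub> (z \<otimes>\<^bsub>L\<^esub> x) = \<ominus>\<^bsub>L\<^esub> (y \<otimes>\<^bsub>L\<^esub> (x \<otimes>\<^bsub>L\<^esub> z))"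
    using bracket_anticommute[OF z x] c by (simp add: bracket_uminus_right)
  have 2: "z \<otimes>\<^bsub>L\<^esub> (x \<otimes>\<^bsub>L\<^esub> y) = \<ominus>\<^bsub>L\<^esub> ((x \<otimes>\<^bsub>L\<^esub> y) \<otimes>\<^bsub>L\<^esub> z)"
    using c by (intro bracket_anticommute) auto
  have "x \<otimes>\<^bsub>L\<^esub> (y \<otimes>\<^bsub>L\<^esub> z) \<oplus>\<^bsub>L\<^esub>
      \<ominus>\<^bsub>L\<^esub> ((x \<otimes>\<^bsub>L\<^esub> y) \<otimes>\<^bsub>L\<^esub> z \<oplus>\<^bsub>L\<^esub> y \<otimes>\<^bsub>L\<^esub> (x \<otimes>\<^bsub>L\<^esub> z)) = \<zero>\<^bsub>L\<^esub>"
    using jacobi[OF x y z] c unfolding 1 2 by (simp add: M.minus_add M.add.m_ac)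
  then show ?thesis
    using c by (metis M.add.inv_closed M.add.m_closed M.minus_equality M.minus_minus)
qed

lemma ideal_subspace: "lie_ideal F I L \<Longrightarrow> subspace F I L"
  by (simp add: lie_ideal_def)

lemma ideal_bracket:
  assumes "lie_ideal F I L" "x \<in> I" "y \<in> carrier L"
  shows "x \<otimes>\<^bsub>L\<^esub> y \<in> I" "y \<otimes>\<^bsub>L\<^esub> x \<in> I"
proof -
  show *: "x \<otimes>\<^bsub>L\<^esub> y \<in> I"
    using assms by (simp add: lie_ideal_def)
  show "y \<otimes>\<^bsub>L\<^esub> x \<in> I"
    using bracket_anticommute[of y x] subspace_uminus[OF _ *] assms
      subspace_carrier[OF ideal_subspace[OF assms(1)] assms(2)]
    by (simp add: ideal_subspace)
qed

lemma ideal_subalgebra: "lie_ideal F I L \<Longrightarrow> lie_subalgebra F I L"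
  unfolding lie_ideal_def lie_subalgebra_def using subspace_carrier by blast

lemma ideal_whole: "lie_ideal F (carrier L) L"
  by (simp add: lie_ideal_def subspace_whole bracket_closed)

lemma ideal_trivial: "lie_ideal F {\<zero>\<^bsub>L\<^esub>} L"
  by (simp add: lie_ideal_def subspace_trivial bracket_zero_left)

lemma ad_pow_closed:
  assumes "x \<in> carrier L" "y \<in> carrier L"
  shows "(lie_ad L x ^^ n) y \<in> carrier L"
  by (induction n) (simp_all add: assms lie_ad_def bracket_closed)

lemma ad_pow_zero: "x \<in> carrier L \<Longrightarrow> (lie_ad L x ^^ n) \<zero>\<^bsub>L\<^esub> = \<zero>\<^bsub>L\<^esub>"
  by (induction n) (simp_all add: lie_ad_def bracket_zero_right)

lemma ad_pow_add:
  assumes "x \<in> carrier L" "y \<in> carrier L" "z \<in> carrier L"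
  shows "(lie_ad L x ^^ n) (y \<oplus>\<^bsub>L\<^esub> z) = (lie_ad L x ^^ n) y \<oplus>\<^bsub>L\<^esub> (lie_ad L x ^^ n) z"
  using ad_pow_closed[OF assms(1)] assms
  by (induction n) (simp_all add: lie_ad_def bracket_add_right)

lemma ad_pow_smult:
  assumes "x \<in> carrier L" "c \<in> carrier F" "y \<in> carrier L"
  shows "(lie_ad L x ^^ n) (c \<odot>\<^bsub>L\<^esub> y) = c \<odot>\<^bsub>L\<^esub> (lie_ad L x ^^ n) y"
  using ad_pow_closed[OF assms(1)] assms
  by (induction n) (simp_all add: lie_ad_def bracket_smult_right)

lemma ad_pow_Suc: "(lie_ad L x ^^ Suc n) y = (lie_ad L x ^^ n) (x \<otimes>\<^bsub>L\<^esub> y)"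
  by (simp only: funpow_Suc_right comp_def lie_ad_def)

lemma ad_pow_plus: "(lie_ad L x ^^ (m + n)) y = (lie_ad L x ^^ m) ((lie_ad L x ^^ n) y)"
  by (simp add: funpow_add)

lemma ad_pow_vanishes_mono:
  assumes "x \<in> carrier L" "(lie_ad L x ^^ m) y = \<zero>\<^bsub>L\<^esub>" "m \<le> n"
  shows "(lie_ad L x ^^ n) y = \<zero>\<^bsub>L\<^esub>"
  using ad_pow_plus[of "n - m" m x y] assms by (simp add: ad_pow_zero)

text \<open>As \<open>ad x\<close> is a derivation, a power high enough for both factors kills a product: in the
  binomial expansion of the power \<open>m + n\<close> each term has at least \<open>m\<close> applications on the left
  or \<open>n\<close> on the right. Peeling off one application at a time avoids the binomial coefficients.\<close>

lemma ad_pow_bracket_vanishes: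
  assumes x: "x \<in> carrier L"
  shows "y \<in> carrier L \<Longrightarrow> z \<in> carrier L \<Longrightarrow> (lie_ad L x ^^ m) y = \<zero>\<^bsub>L\<^esub> \<Longrightarrow>
    (lie_ad L x ^^ n) z = \<zero>\<^bsub>L\<^esub> \<Longrightarrow> (lie_ad L x ^^ (m + n)) (y \<otimes>\<^bsub>L\<^esub> z) = \<zero>\<^bsub>L\<^esub>"
proof (induction "m + n" arbitrary: m n y z)
  case 0
  then show ?case by (simp add: bracket_zero_left)
next
  case (Suc k)
  note yz = Suc.prems(1,2)
  show ?case
  proof (cases "m = 0 \<or> n = 0")
    case True
    then have "y \<otimes>\<^bsub>L\<^esub> z = \<zero>\<^bsub>L\<^esub>"
      using Suc.prems by (auto simp: bracket_zero_left bracket_zero_right)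
    then show ?thesis
      using x by (simp add: ad_pow_zero)
  next
    case False
    then obtain m' n' where mn: "m = Suc m'" "n = Suc n'"
      by (metis not0_implies_Suc)
    have k: "k = m' + n" "k = m + n'" "m + n = Suc k"
      using Suc.hyps(2) mn by auto
    have left: "(lie_ad L x ^^ k) ((x \<otimes>\<^bsub>L\<^esub> y) \<otimes>\<^bsub>L\<^esub> z) = \<zero>\<^bsub>L\<^esub>"
      using Suc.hyps(1)[OF k(1) bracket_closed[OF x yz(1)] yz(2)] Suc.prems(3,4) k(1)
      by (simp only: mn(1) ad_pow_Suc)
    have right: "(lie_ad L x ^^ k) (y \<otimes>\<^bsub>L\<^esub> (x \<otimes>\<^bsub>L\<^esub> z)) = \<zero>\<^bsub>L\<^esub>"
      using Suc.hyps(1)[OF k(2) yz(1) bracket_closed[OF x yz(2)]] Suc.prems(3,4) k(2)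
      by (simp only: mn(2) ad_pow_Suc)
    have "(lie_ad L x ^^ (m + n)) (y \<otimes>\<^bsub>L\<^esub> z) =
        (lie_ad L x ^^ k) ((x \<otimes>\<^bsub>L\<^esub> y) \<otimes>\<^bsub>L\<^esub> z \<oplus>\<^bsub>L\<^esub> y \<otimes>\<^bsub>L\<^esub> (x \<otimes>\<^bsub>L\<^esub> z))"
      by (simp only: k(3) ad_pow_Suc bracket_leibniz[OF x yz])
    then show ?thesis
      using x yz by (simp add: ad_pow_add left right bracket_closed)
  qed
qed

lemma engel_subalgebra_subalgebra:
  assumes x: "x \<in> carrier L"
  shows "lie_subalgebra F (engel_subalgebra L x) L"
  unfolding lie_subalgebra_def
proof (intro conjI ballI subspaceI)
  show "engel_subalgebra L x \<subseteq> carrier L"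
    by (auto simp: engel_subalgebra_def)
  show "\<zero>\<^bsub>L\<^esub> \<in> engel_subalgebra L x"
    using ad_pow_zero[OF x] by (auto simp: engel_subalgebra_def)
next
  fix c v assume c: "c \<in> carrier F" and "v \<in> engel_subalgebra L x"
  then obtain n where v: "v \<in> carrier L" "(lie_ad L x ^^ n) v = \<zero>\<^bsub>L\<^esub>"
    by (auto simp: engel_subalgebra_def)
  have "(lie_ad L x ^^ n) (c \<odot>\<^bsub>L\<^esub> v) = \<zero>\<^bsub>L\<^esub>"
    using ad_pow_smult[OF x c v(1)] v(2) c by simp
  then show "c \<odot>\<^bsub>L\<^esub> v \<in> engel_subalgebra L x"
    using c v(1) by (auto simp: engel_subalgebra_def)
next
  fix v w assume "v \<in> engel_subalgebra L x" "w \<in> engel_subalgebra L x"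
  then obtain m n where *: "v \<in> carrier L" "w \<in> carrier L"
    "(lie_ad L x ^^ m) v = \<zero>\<^bsub>L\<^esub>" "(lie_ad L x ^^ n) w = \<zero>\<^bsub>L\<^esub>"
    by (auto simp: engel_subalgebra_def)
  have "(lie_ad L x ^^ (m + n)) (v \<oplus>\<^bsub>L\<^esub> w) = \<zero>\<^bsub>L\<^esub>"
    using ad_pow_add[OF x *(1,2)] ad_pow_vanishes_mono[OF x *(3), of "m + n"]
      ad_pow_vanishes_mono[OF x *(4), of "m + n"] by simp
  then show "v \<oplus>\<^bsub>L\<^esub> w \<in> engel_subalgebra L x"
    using *(1,2) by (auto simp: engel_subalgebra_def)
next
  fix v w assume "v \<in> engel_subalgebra L x" "w \<in> engel_subalgebra L x"
  then obtain m n where *: "v \<in> carrier L" "w \<in> carrier L"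
    "(lie_ad L x ^^ m) v = \<zero>\<^bsub>L\<^esub>" "(lie_ad L x ^^ n) w = \<zero>\<^bsub>L\<^esub>"
    by (auto simp: engel_subalgebra_def)
  show "v \<otimes>\<^bsub>L\<^esub> w \<in> engel_subalgebra L x"
    using ad_pow_bracket_vanishes[OF x *] bracket_closed[OF *(1,2)]
    by (auto simp: engel_subalgebra_def)
qed

lemma mem_engel_subalgebra: "x \<in> carrier L \<Longrightarrow> x \<in> engel_subalgebra L x"
  unfolding engel_subalgebra_def
  by (intro CollectI conjI exI[of _ 1]) (simp_all add: lie_ad_def bracket_self)

text \<open>Fitting decomposition of \<open>L\<close> under \<open>ad x\<close>. The images of the powers of \<open>ad x\<close>
  decrease, so from some power \<open>m\<close> on they no longer change. Then every \<open>y\<close> has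
  \<open>(ad x)\<^sup>m y = (ad x)\<^sup>m w\<close> with \<open>w\<close> in the image of the power \<open>n + m\<close>, hence in \<open>B\<close>, and the
  difference \<open>y - w\<close> lies in the Engel subalgebra.\<close>

lemma engel_subalgebra_supplement:
  assumes fd: "fin_dim" and x: "x \<in> carrier L" and B: "subspace F B L"
    and E: "engel_subalgebra L x \<subseteq> B" and im: "\<And>y. y \<in> carrier L \<Longrightarrow> (lie_ad L x ^^ n) y \<in> B"
  shows "B = carrier L"
proof
  show "B \<subseteq> carrier L" by (rule subspace_subset[OF B])
  define W where "W k = (lie_ad L x ^^ k) ` carrier L" for k
  have sub: "subspace F (W k) L" for k
  proof (rule subspaceI)
    show "W k \<subseteq> carrier L"
      using ad_pow_closed[OF x] by (auto simp: W_def)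
    show "\<zero>\<^bsub>L\<^esub> \<in> W k"
      unfolding W_def using ad_pow_zero[OF x, of k] by (metis M.zero_closed image_eqI)
    fix v w assume "v \<in> W k" "w \<in> W k"
    then obtain v' w' where *: "v' \<in> carrier L" "w' \<in> carrier L"
      "v = (lie_ad L x ^^ k) v'" "w = (lie_ad L x ^^ k) w'"
      by (auto simp: W_def)
    then have "v \<oplus>\<^bsub>L\<^esub> w = (lie_ad L x ^^ k) (v' \<oplus>\<^bsub>L\<^esub> w')"
      using ad_pow_add[OF x] by simp
    then show "v \<oplus>\<^bsub>L\<^esub> w \<in> W k"
      unfolding W_def using * by blast
  next
    fix c v assume c: "c \<in> carrier F" and "v \<in> W k"
    then obtain v' where *: "v' \<in> carrier L" "v = (lie_ad L x ^^ k) v'"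
      by (auto simp: W_def)
    then have "c \<odot>\<^bsub>L\<^esub> v = (lie_ad L x ^^ k) (c \<odot>\<^bsub>L\<^esub> v')"
      using ad_pow_smult[OF x c] by simp
    then show "c \<odot>\<^bsub>L\<^esub> v \<in> W k"
      unfolding W_def using * c by blast
  qed
  have "W (Suc k) \<subseteq> W k" for k
    unfolding W_def using ad_pow_Suc bracket_closed[OF x] by (metis image_eqI image_subsetI)
  then obtain m where m: "W (Suc m) = W m"
    using decreasing_subspaces_stabilise[OF fd sub] by metis
  have stable: "W (j + m) = W m" for j
  proof (induction j)
    case (Suc j)
    have "W (Suc (j + m)) = lie_ad L x ` W (j + m)"
      by (simp add: W_def image_comp)
    also have "\<dots> = W (Suc m)"
      by (simp add: Suc.IH) (simp add: W_def image_comp)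
    finally show ?case
      by (simp add: m)
  qed simp
  show "carrier L \<subseteq> B"
  proof
    fix y assume y: "y \<in> carrier L"
    have "(lie_ad L x ^^ m) y \<in> W ((m + n) + m)"
      unfolding stable using y by (simp add: W_def)
    then obtain z where z: "z \<in> carrier L"
      "(lie_ad L x ^^ m) y = (lie_ad L x ^^ (m + (n + m))) z"
      by (auto simp: W_def ac_simps)
    define w where "w = (lie_ad L x ^^ n) ((lie_ad L x ^^ m) z)"
    have w: "w \<in> B" "w \<in> carrier L" "(lie_ad L x ^^ m) y = (lie_ad L x ^^ m) w"
      using z im ad_pow_closed[OF x] by (simp_all add: w_def ad_pow_plus)
    have "(lie_ad L x ^^ m) (y \<oplus>\<^bsub>L\<^esub> (\<ominus>\<^bsub>F\<^esub> \<one>\<^bsub>F\<^esub>) \<odot>\<^bsub>L\<^esub> w) =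
        (lie_ad L x ^^ m) y \<oplus>\<^bsub>L\<^esub> (\<ominus>\<^bsub>F\<^esub> \<one>\<^bsub>F\<^esub>) \<odot>\<^bsub>L\<^esub> (lie_ad L x ^^ m) w"
      using x y w(2) by (simp add: ad_pow_add ad_pow_smult)
    also have "\<dots> = \<zero>\<^bsub>L\<^esub>"
      using w ad_pow_closed[OF x] by (simp add: smult_minus_1 M.r_neg)
    finally have "y \<oplus>\<^bsub>L\<^esub> (\<ominus>\<^bsub>F\<^esub> \<one>\<^bsub>F\<^esub>) \<odot>\<^bsub>L\<^esub> w \<in> engel_subalgebra L x"
      using y w(2) by (auto simp: engel_subalgebra_def)
    then have "(y \<oplus>\<^bsub>L\<^esub> (\<ominus>\<^bsub>F\<^esub> \<one>\<^bsub>F\<^esub>) \<odot>\<^bsub>L\<^esub> w) \<oplus>\<^bsub>L\<^esub> w \<in> B"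
      using E w(1) subspace_add[OF B] by blast
    then show "y \<in> B"
      using y w(2) by (simp add: smult_minus_1 M.a_assoc M.l_neg)
  qed
qed

text \<open>The kernels of the powers of \<open>ad x\<close> increase, so in finite dimension one of them contains all
  others.\<close>

lemma ad_pow_uniformly_vanishes:
  assumes fd: "fin_dim" and x: "x \<in> carrier L" and E: "engel_subalgebra L x = carrier L"
  obtains n where "\<And>y. y \<in> carrier L \<Longrightarrow> (lie_ad L x ^^ n) y = \<zero>\<^bsub>L\<^esub>"
proof -
  define Z where "Z n = {y \<in> carrier L. (lie_ad L x ^^ n) y = \<zero>\<^bsub>L\<^esub>}" for n
  have sub: "subspace F (Z n) L" for n
    by (rule subspaceI) (auto simp: Z_def ad_pow_zero x ad_pow_add ad_pow_smult)
  have "subspace F W L" if "W \<in> range Z" for W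
    using that sub by blast
  then obtain M where M: "M \<in> range Z" "\<And>W. W \<in> range Z \<Longrightarrow> M \<subseteq> W \<Longrightarrow> W = M"
    using maximal_subspace_exists[OF fd, of "\<lambda>W. W \<in> range Z", OF _ rangeI] by metis
  then obtain n where "M = Z n"
    by blast
  then have n: "Z k = Z n" if "Z n \<subseteq> Z k" for k
    using M(2)[of "Z k"] that by simp
  show thesis
  proof (rule that)
    fix y assume y: "y \<in> carrier L"
    then obtain k where "y \<in> Z k"
      using E by (auto simp: engel_subalgebra_def Z_def)
    then have "y \<in> Z (max n k)"
      using ad_pow_vanishes_mono[OF x] by (auto simp: Z_def)
    moreover have "Z n \<subseteq> Z (max n k)"
      using ad_pow_vanishes_mono[OF x] by (auto simp: Z_def)
    ultimately show "(lie_ad L x ^^ n) y = \<zero>\<^bsub>L\<^esub>"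
      using n by (auto simp: Z_def)
  qed
qed

end

section \<open>Engel's theorem\<close>

context lie_algebra
begin

text \<open>Since \<open>[v, v] = 0\<close>, all brackets between elements of \<open>K + F v\<close> even lie in \<open>K\<close>.\<close>

lemma adjoin_subalgebra:
  assumes K: "lie_subalgebra F K L" and v: "v \<in> carrier L" and act: "\<And>k. k \<in> K \<Longrightarrow> k \<otimes>\<^bsub>L\<^esub> v \<in> K"
  shows "lie_subalgebra F (adjoin K v) L"
  unfolding lie_subalgebra_def
proof (intro conjI ballI)
  have Ks: "subspace F K L" and Kb: "\<And>x y. x \<in> K \<Longrightarrow> y \<in> K \<Longrightarrow> x \<otimes>\<^bsub>L\<^esub> y \<in> K"
    using K by (auto simp: lie_subalgebra_def)
  note KD = subspaceD[OF Ks]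
  show "subspace F (adjoin K v) L"
    by (rule adjoin_subspace[OF Ks v])
  have act': "v \<otimes>\<^bsub>L\<^esub> k \<in> K" if "k \<in> K" for k
    using bracket_anticommute[OF v KD(2)] subspace_uminus[OF Ks act] that by simp
  fix x y assume "x \<in> adjoin K v" "y \<in> adjoin K v"
  then obtain k a l b where *: "k \<in> K" "a \<in> carrier F" "x = k \<oplus>\<^bsub>L\<^esub> a \<odot>\<^bsub>L\<^esub> v"
    "l \<in> K" "b \<in> carrier F" "y = l \<oplus>\<^bsub>L\<^esub> b \<odot>\<^bsub>L\<^esub> v"
    by (auto simp: adjoin_def)
  note c = KD(2)[OF *(1)] KD(2)[OF *(4)] *(2,5) v
  have "x \<otimes>\<^bsub>L\<^esub> y = k \<otimes>\<^bsub>L\<^esub> l \<oplus>\<^bsub>L\<^esub> a \<odot>\<^bsub>L\<^esub> (v \<otimes>\<^bsub>L\<^esub> l) \<oplus>\<^bsub>L\<^esub> b \<odot>\<^bsub>L\<^esub> (k \<otimes>\<^bsub>L\<^esub> v)"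
    using c by (simp add: *(3,6) bracket_add_left bracket_add_right bracket_smult_left
        bracket_smult_right bracket_self bracket_closed)
  then have "x \<otimes>\<^bsub>L\<^esub> y \<in> K"
    using * act act' by (simp add: KD(4,5) Kb)
  then show "x \<otimes>\<^bsub>L\<^esub> y \<in> adjoin K v"
    using adjoin_superset[OF Ks v] by blast
qed

text \<open>The heart of Engel's theorem, in a relative form that replaces the quotient module \<open>V / W\<close>
  by the pair \<open>W \<subset> V\<close>. The induction is on \<open>H\<close>. A maximal proper subalgebra \<open>K\<close> of \<open>H\<close> acts on the
  pair \<open>K \<subset> H\<close>, and the statement for that pair yields \<open>v\<close> with \<open>H = K + F v\<close>
  and \<open>[K, v] \<subseteq> K\<close>. By the statement for \<open>K\<close> on \<open>W \<subset> V\<close>, the vectors that \<open>K\<close> sends into \<open>W\<close>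
  form a space \<open>V'\<close> strictly above \<open>W\<close>; it is stable under \<open>ad v\<close>, because \<open>K\<close> is an ideal of \<open>H\<close>.
  As \<open>ad v\<close> is nilpotent, the last of the iterates of an element of \<open>V' - W\<close> that is still
  outside \<open>W\<close> is sent into \<open>W\<close> by \<open>v\<close> too.\<close>

lemma engel_common_vector:
  assumes fd: "fin_dim"
  shows "lie_subalgebra F H L \<Longrightarrow> (\<And>h. h \<in> H \<Longrightarrow> engel_subalgebra L h = carrier L) \<Longrightarrow>
    subspace F V L \<Longrightarrow> subspace F W L \<Longrightarrow> W \<subset> V \<Longrightarrow>
    (\<And>h v. h \<in> H \<Longrightarrow> v \<in> V \<Longrightarrow> h \<otimes>\<^bsub>L\<^esub> v \<in> V) \<Longrightarrow>
    (\<And>h w. h \<in> H \<Longrightarrow> w \<in> W \<Longrightarrow> h \<otimes>\<^bsub>L\<^esub> w \<in> W) \<Longrightarrow>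
    \<exists>v\<in>V - W. \<forall>h\<in>H. h \<otimes>\<^bsub>L\<^esub> v \<in> W"
proof (induction "rank H" arbitrary: H V W rule: less_induct)
  case less
  note nil = less.prems(2) and V = less.prems(3) and W = less.prems(4) and WV = less.prems(5)
    and HV = less.prems(6) and HW = less.prems(7)
  have Hs: "subspace F H L" and Hb: "\<And>x y. x \<in> H \<Longrightarrow> y \<in> H \<Longrightarrow> x \<otimes>\<^bsub>L\<^esub> y \<in> H"
    using less.prems(1) by (auto simp: lie_subalgebra_def)
  note HD = subspaceD[OF Hs] and VD = subspaceD[OF V] and WD = subspaceD[OF W]
  show ?case
  proof (cases "H = {\<zero>\<^bsub>L\<^esub>}")
    case True
    obtain v where "v \<in> V" "v \<notin> W"
      using WV by blast
    then show ?thesis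
      using True VD(2) WD(3) by (intro bexI[of _ v]) (auto simp: bracket_zero_left)
  next
    case False
    have triv: "lie_subalgebra F {\<zero>\<^bsub>L\<^esub>} L \<and> {\<zero>\<^bsub>L\<^esub>} \<subset> H"
      using ideal_subalgebra[OF ideal_trivial] False HD(3) by blast
    have "subspace F U L" if "lie_subalgebra F U L \<and> U \<subset> H" for U
      using that by (simp add: lie_subalgebra_def)
    then obtain K where "lie_subalgebra F K L \<and> K \<subset> H"
      and Kmax: "\<And>U. lie_subalgebra F U L \<and> U \<subset> H \<Longrightarrow> K \<subseteq> U \<Longrightarrow> U = K"
      using maximal_subspace_exists[OF fd, of "\<lambda>U. lie_subalgebra F U L \<and> U \<subset> H", OF _ triv]
      by metis
    then have K: "lie_subalgebra F K L" "K \<subset> H"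
      by auto
    have Ks: "subspace F K L" and Kb: "\<And>x y. x \<in> K \<Longrightarrow> y \<in> K \<Longrightarrow> x \<otimes>\<^bsub>L\<^esub> y \<in> K"
      using K(1) by (auto simp: lie_subalgebra_def)
    have KH: "k \<in> H" if "k \<in> K" for k
      using K(2) that by blast
    have less_rank: "rank K < rank H"
      by (rule rank_strict_mono[OF fd Ks Hs K(2)])
    have "\<exists>v\<in>H - K. \<forall>k\<in>K. k \<otimes>\<^bsub>L\<^esub> v \<in> K"
      by (rule less.hyps[OF less_rank K(1) _ Hs Ks K(2)]) (simp_all add: nil KH Hb Kb)
    then obtain v where v: "v \<in> H" "v \<notin> K" and Kv: "\<And>k. k \<in> K \<Longrightarrow> k \<otimes>\<^bsub>L\<^esub> v \<in> K"
      by blast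
    note vL = HD(2)[OF v(1)]
    \<comment> \<open>\<open>K + F v\<close> is a subalgebra of \<open>H\<close> above \<open>K\<close>, and \<open>K\<close> was maximal.\<close>
    have H_eq: "H = adjoin K v"
    proof (rule ccontr)
      assume "H \<noteq> adjoin K v"
      moreover have "adjoin K v \<subseteq> H"
        using K(2) v(1) by (intro adjoin_least[OF Hs]) auto
      ultimately have "adjoin K v = K"
        using Kmax[of "adjoin K v"] adjoin_subalgebra[OF K(1) vL Kv] adjoin_superset[OF Ks vL] by blast
      then show False
        using adjoin_mem[OF Ks vL] v(2) by blast
    qed
    have "\<exists>u\<in>V - W. \<forall>k\<in>K. k \<otimes>\<^bsub>L\<^esub> u \<in> W"
      by (rule less.hyps[OF less_rank K(1) _ V W WV]) (simp_all add: nil KH HV HW)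
    then obtain u where u: "u \<in> V" "u \<notin> W" "\<And>k. k \<in> K \<Longrightarrow> k \<otimes>\<^bsub>L\<^esub> u \<in> W"
      by blast
    define T where "T = lie_ad L v"
    have T_pow: "(T ^^ n) u \<in> V \<and> (\<forall>k\<in>K. k \<otimes>\<^bsub>L\<^esub> (T ^^ n) u \<in> W)" for n
    proof (induction n)
      case 0
      then show ?case using u by simp
    next
      case (Suc n)
      define t where "t = (T ^^ n) u"
      have t: "t \<in> V" "t \<in> carrier L" "\<And>k. k \<in> K \<Longrightarrow> k \<otimes>\<^bsub>L\<^esub> t \<in> W"
        using Suc VD(2) by (auto simp: t_def)
      have "k \<otimes>\<^bsub>L\<^esub> (v \<otimes>\<^bsub>L\<^esub> t) \<in> W" if k: "k \<in> K" for k
        using bracket_leibniz[OF HD(2)[OF KH[OF k]] vL t(2)]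
          WD(4)[OF t(3)[OF Kv[OF k]] HW[OF v(1) t(3)[OF k]]] by simp
      moreover have "(T ^^ Suc n) u = v \<otimes>\<^bsub>L\<^esub> t"
        unfolding t_def T_def by (simp add: lie_ad_def)
      ultimately show ?case
        using HV[OF v(1) t(1)] by simp
    qed
    have "u \<in> engel_subalgebra L v"
      using nil[OF v(1)] VD(2)[OF u(1)] by simp
    then obtain N where "(T ^^ N) u = \<zero>\<^bsub>L\<^esub>"
      by (auto simp: engel_subalgebra_def T_def)
    then have "(T ^^ N) u \<in> W"
      using WD(3) by simp
    then obtain n where n: "(T ^^ n) u \<in> W" "\<And>m. m < n \<Longrightarrow> (T ^^ m) u \<notin> W"
      using exists_least_iff[of "\<lambda>n. (T ^^ n) u \<in> W"] by blast
    then obtain m where m: "n = Suc m"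
      using u(2) by (cases n) auto
    define t where "t = (T ^^ m) u"
    have t: "t \<in> V" "t \<in> carrier L" "t \<notin> W" "\<And>k. k \<in> K \<Longrightarrow> k \<otimes>\<^bsub>L\<^esub> t \<in> W" "v \<otimes>\<^bsub>L\<^esub> t \<in> W"
      using T_pow[of m] VD(2) n m by (auto simp: t_def T_def lie_ad_def)
    have "h \<otimes>\<^bsub>L\<^esub> t \<in> W" if "h \<in> H" for h
    proof -
      obtain k a where k: "k \<in> K" "a \<in> carrier F" "h = k \<oplus>\<^bsub>L\<^esub> a \<odot>\<^bsub>L\<^esub> v"
        using \<open>h \<in> H\<close> unfolding H_eq adjoin_def by blast
      then have "h \<otimes>\<^bsub>L\<^esub> t = k \<otimes>\<^bsub>L\<^esub> t \<oplus>\<^bsub>L\<^esub> a \<odot>\<^bsub>L\<^esub> (v \<otimes>\<^bsub>L\<^esub> t)"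
        using t(2) vL HD(2)[OF KH[OF k(1)]] by (simp add: bracket_add_left bracket_smult_left)
      then show ?thesis
        using WD(4)[OF t(4)[OF k(1)] WD(5)[OF k(2) t(5)]] by simp
    qed
    then show ?thesis
      using t(1,3) by blast
  qed
qed

lemma bracket_set_span_ideal:
  assumes I: "lie_ideal F I L"
  shows "lie_ideal F (span {x \<otimes>\<^bsub>L\<^esub> y | x y. x \<in> I \<and> y \<in> carrier L}) L"
    and "span {x \<otimes>\<^bsub>L\<^esub> y | x y. x \<in> I \<and> y \<in> carrier L} \<subseteq> I"
proof -
  let ?S = "{x \<otimes>\<^bsub>L\<^esub> y | x y. x \<in> I \<and> y \<in> carrier L}"
  have SI: "?S \<subseteq> I"
    using ideal_bracket(1)[OF I] by blast
  have Is: "subspace F I L"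
    by (rule ideal_subspace[OF I])
  then have SL: "?S \<subseteq> carrier L"
    using SI subspace_subset by blast
  show sub: "span ?S \<subseteq> I"
    by (rule span_is_subset[OF SI]) (simp add: Is)
  show "lie_ideal F (span ?S) L"
    unfolding lie_ideal_def
  proof (intro conjI ballI)
    show "subspace F (span ?S) L"
      by (rule span_is_subspace[OF SL])
    fix x y assume "x \<in> span ?S" "y \<in> carrier L"
    then have "x \<otimes>\<^bsub>L\<^esub> y \<in> ?S"
      using sub by blast
    then show "x \<otimes>\<^bsub>L\<^esub> y \<in> span ?S"
      using in_own_span[OF SL] by blast
  qed
qed

lemma lower_central_series_ideal: "lie_ideal F (lower_central_series F L n) L"
  by (induction n) (simp_all add: ideal_whole bracket_set_span_ideal(1))

lemma lower_central_series_decreasing: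
  "lower_central_series F L (Suc n) \<subseteq> lower_central_series F L n"
  using bracket_set_span_ideal(2)[OF lower_central_series_ideal] by simp

lemma ad_pow_in_lower_central_series:
  assumes x: "x \<in> carrier L" and y: "y \<in> carrier L"
  shows "(lie_ad L x ^^ n) y \<in> lower_central_series F L n"
proof (induction n)
  case (Suc n)
  let ?S = "{a \<otimes>\<^bsub>L\<^esub> b | a b. a \<in> lower_central_series F L n \<and> b \<in> carrier L}"
  define z where "z = (lie_ad L x ^^ n) y"
  note I = lower_central_series_ideal[of n]
  have z: "z \<in> lower_central_series F L n" "z \<in> carrier L"
    using Suc ad_pow_closed[OF x y] by (simp_all add: z_def)
  have S: "?S \<subseteq> carrier L"
    using subspace_carrier[OF ideal_subspace[OF I]] bracket_closed by blast
  have "z \<otimes>\<^bsub>L\<^esub> x \<in> span ?S"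
    using in_own_span[OF S] z(1) x by blast
  then have "\<ominus>\<^bsub>L\<^esub> (z \<otimes>\<^bsub>L\<^esub> x) \<in> span ?S"
    by (rule subspace_uminus[OF span_is_subspace[OF S]])
  moreover have "(lie_ad L x ^^ Suc n) y = x \<otimes>\<^bsub>L\<^esub> z"
    unfolding z_def by (simp add: lie_ad_def)
  ultimately show ?case
    using bracket_anticommute[OF x z(2)] by simp
qed (simp add: y)

text \<open>Choose an ideal \<open>W\<close> maximal among those strictly inside \<open>I\<close>. A vector of \<open>I - W\<close> that \<open>L\<close> sends
  into \<open>W\<close> spans \<open>I\<close> together with \<open>W\<close>, by maximality; hence \<open>[I, L] \<subseteq> W\<close>.\<close>

lemma bracket_set_span_proper:
  assumes fd: "fin_dim" and nil: "\<And>x. x \<in> carrier L \<Longrightarrow> engel_subalgebra L x = carrier L"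
    and I: "lie_ideal F I L" and nz: "I \<noteq> {\<zero>\<^bsub>L\<^esub>}"
  shows "span {x \<otimes>\<^bsub>L\<^esub> y | x y. x \<in> I \<and> y \<in> carrier L} \<noteq> I"
proof -
  let ?S = "{x \<otimes>\<^bsub>L\<^esub> y | x y. x \<in> I \<and> y \<in> carrier L}"
  note Is = ideal_subspace[OF I]
  have triv: "lie_ideal F {\<zero>\<^bsub>L\<^esub>} L \<and> {\<zero>\<^bsub>L\<^esub>} \<subset> I"
    using ideal_trivial nz subspace_zero[OF Is] by blast
  have "subspace F U L" if "lie_ideal F U L \<and> U \<subset> I" for U
    using that by (simp add: lie_ideal_def)
  then obtain W where "lie_ideal F W L \<and> W \<subset> I"
    and Wmax: "\<And>U. lie_ideal F U L \<and> U \<subset> I \<Longrightarrow> W \<subseteq> U \<Longrightarrow> U = W"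
    using maximal_subspace_exists[OF fd, of "\<lambda>U. lie_ideal F U L \<and> U \<subset> I", OF _ triv] by metis
  then have W: "lie_ideal F W L" "W \<subset> I"
    by auto
  note Ws = ideal_subspace[OF W(1)]
  note WD = subspaceD[OF Ws]
  have "\<exists>v\<in>I - W. \<forall>h\<in>carrier L. h \<otimes>\<^bsub>L\<^esub> v \<in> W"
    by (rule engel_common_vector[OF fd ideal_subalgebra[OF ideal_whole] nil Is Ws W(2)
          ideal_bracket(2)[OF I] ideal_bracket(2)[OF W(1)]])
  then obtain v where v: "v \<in> I" "v \<notin> W" "\<And>h. h \<in> carrier L \<Longrightarrow> h \<otimes>\<^bsub>L\<^esub> v \<in> W"
    by blast
  note vL = subspace_carrier[OF Is v(1)]
  have into_W: "x \<otimes>\<^bsub>L\<^esub> y \<in> W" if x: "x \<in> adjoin W v" and y: "y \<in> carrier L" for x y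
  proof -
    obtain w a where w: "w \<in> W" "a \<in> carrier F" "x = w \<oplus>\<^bsub>L\<^esub> a \<odot>\<^bsub>L\<^esub> v"
      using x unfolding adjoin_def by blast
    have "v \<otimes>\<^bsub>L\<^esub> y \<in> W"
      using bracket_anticommute[OF vL y] subspace_uminus[OF Ws v(3)[OF y]] by simp
    then have "w \<otimes>\<^bsub>L\<^esub> y \<oplus>\<^bsub>L\<^esub> a \<odot>\<^bsub>L\<^esub> (v \<otimes>\<^bsub>L\<^esub> y) \<in> W"
      using ideal_bracket(1)[OF W(1) w(1) y] w(2) WD(4,5) by blast
    then show ?thesis
      using w vL y WD(2) by (simp add: bracket_add_left bracket_smult_left)
  qed
  have "lie_ideal F (adjoin W v) L"
    unfolding lie_ideal_def
    using adjoin_subspace[OF Ws vL] into_W adjoin_superset[OF Ws vL] by blast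
  moreover have "adjoin W v \<subseteq> I"
    using W(2) v(1) by (intro adjoin_least[OF Is]) auto
  ultimately have "adjoin W v = I"
    using Wmax[of "adjoin W v"] adjoin_superset[OF Ws vL] adjoin_mem[OF Ws vL] v(2) by blast
  then have "?S \<subseteq> W"
    using into_W by blast
  then have "span ?S \<subseteq> W"
    by (rule span_is_subset) (simp add: Ws)
  then show ?thesis
    using W(2) by blast
qed

text \<open>Engel's theorem: in finite dimension the lower central series becomes constant, and by the
  preceding lemma this can only happen at zero.\<close>

theorem engel:
  assumes fd: "fin_dim" and nil: "\<And>x. x \<in> carrier L \<Longrightarrow> engel_subalgebra L x = carrier L"
  shows "lie_nilpotent F L"
proof -
  obtain n where n: "lower_central_series F L (Suc n) = lower_central_series F L n"
    by (rule decreasing_subspaces_stabilise[OF fd, of "lower_central_series F L"])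
      (rule ideal_subspace[OF lower_central_series_ideal], rule lower_central_series_decreasing)
  then have "lower_central_series F L n = {\<zero>\<^bsub>L\<^esub>}"
    using bracket_set_span_proper[OF fd nil lower_central_series_ideal[of n]] by auto
  then show ?thesis
    unfolding lie_nilpotent_def by blast
qed

lemma nilpotent_engel_subalgebra:
  assumes "lie_nilpotent F L" and x: "x \<in> carrier L"
  shows "engel_subalgebra L x = carrier L"
proof -
  obtain n where n: "lower_central_series F L n = {\<zero>\<^bsub>L\<^esub>}"
    using assms(1) by (auto simp: lie_nilpotent_def)
  have "(lie_ad L x ^^ n) y = \<zero>\<^bsub>L\<^esub>" if "y \<in> carrier L" for y
    using ad_pow_in_lower_central_series[OF x that, of n] n by simp
  then show ?thesis
    by (auto simp: engel_subalgebra_def)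
qed

end

section \<open>Subalgebras, quotients and cores\<close>

context lie_algebra
begin

lemma restrict_lie_algebra:
  assumes U: "lie_subalgebra F U L"
  shows "lie_algebra F (L\<lparr>carrier := U\<rparr>)"
proof -
  have Us: "subspace F U L" and Ub: "\<And>x y. x \<in> U \<Longrightarrow> y \<in> U \<Longrightarrow> x \<otimes>\<^bsub>L\<^esub> y \<in> U"
    using U by (auto simp: lie_subalgebra_def)
  note UD = subspace_carrier[OF Us]
  show ?thesis
    by (intro lie_algebra.intro subspace_is_vs[OF Us] lie_algebra_axioms.intro)
      (simp_all add: Ub UD bracket_add_left bracket_add_right bracket_smult_left
        bracket_smult_right bracket_self jacobi)
qed

lemma nil_subalgebra_nilpotent:
  assumes fd: "fin_dim" and U: "lie_subalgebra F U L"
    and nil: "\<And>x. x \<in> U \<Longrightarrow> engel_subalgebra L x = carrier L"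
  shows "lie_nilpotent F (L\<lparr>carrier := U\<rparr>)"
proof -
  interpret U: lie_algebra F "L\<lparr>carrier := U\<rparr>"
    by (rule restrict_lie_algebra[OF U])
  have Us: "subspace F U L"
    using U by (simp add: lie_subalgebra_def)
  have ad: "lie_ad (L\<lparr>carrier := U\<rparr>) x = lie_ad L x" for x
    by (simp add: lie_ad_def fun_eq_iff)
  show ?thesis
  proof (rule U.engel[OF subspace_fin_dim[OF fd Us]])
    fix x assume "x \<in> carrier (L\<lparr>carrier := U\<rparr>)"
    then have "U \<subseteq> engel_subalgebra L x"
      using nil subspace_subset[OF Us] by simp
    then show "engel_subalgebra (L\<lparr>carrier := U\<rparr>) x = carrier (L\<lparr>carrier := U\<rparr>)"
      by (auto simp: engel_subalgebra_def ad)
  qed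
qed

end

text \<open>The operations of the quotient are unions over representatives; for an ideal all
  representatives contribute the same coset.\<close>

locale lie_algebra_ideal = lie_algebra +
  fixes B
  assumes ideal: "lie_ideal F B L"
begin

lemmas B_subspace = ideal_subspace[OF ideal]
lemmas B_closed = subspaceD[OF B_subspace]
lemmas B_bracket = ideal_bracket[OF ideal]

sublocale B: abelian_subgroup B L
proof (rule abelian_subgroupI3)
  show "additive_subgroup B L"
    using B_closed subspace_uminus[OF B_subspace]
    by unfold_locales (auto simp flip: a_inv_def)
  show "abelian_group L"
    by (rule M.abelian_group_axioms)
qed

lemma coset_eqI:
  assumes "x \<in> carrier L" "b \<in> B"
  shows "B +>\<^bsub>L\<^esub> (b \<oplus>\<^bsub>L\<^esub> x) = B +>\<^bsub>L\<^esub> x"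
  using M.a_repr_independence[OF M.a_rcosI[OF assms(2) B_closed(1) assms(1)] assms(1) B.a_subgroup]
  by simp

lemma mem_coset: "y \<in> B +>\<^bsub>L\<^esub> x \<longleftrightarrow> (\<exists>b\<in>B. y = b \<oplus>\<^bsub>L\<^esub> x)"
  by (auto simp: a_r_coset_def')

lemma coset_self: "x \<in> carrier L \<Longrightarrow> x \<in> B +>\<^bsub>L\<^esub> x"
  unfolding mem_coset using B_closed(3) by (intro bexI[of _ "\<zero>\<^bsub>L\<^esub>"]) auto

lemma quotient_carrier: "carrier (lie_quotient L B) = (\<lambda>x. B +>\<^bsub>L\<^esub> x) ` carrier L"
  by (auto simp: lie_quotient_def A_RCOSETS_def')

lemma quotient_zero: "\<zero>\<^bsub>lie_quotient L B\<^esub> = B +>\<^bsub>L\<^esub> \<zero>\<^bsub>L\<^esub>"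
  using M.a_coset_add_zero[OF B_closed(1)] by (simp add: lie_quotient_def)

lemma quotient_add:
  assumes "x \<in> carrier L" "y \<in> carrier L"
  shows "(B +>\<^bsub>L\<^esub> x) \<oplus>\<^bsub>lie_quotient L B\<^esub> (B +>\<^bsub>L\<^esub> y) = B +>\<^bsub>L\<^esub> (x \<oplus>\<^bsub>L\<^esub> y)"
  using B.a_rcos_sum[OF assms] by (simp add: lie_quotient_def)

lemma quotient_smult:
  assumes "a \<in> carrier F" "x \<in> carrier L"
  shows "a \<odot>\<^bsub>lie_quotient L B\<^esub> (B +>\<^bsub>L\<^esub> x) = B +>\<^bsub>L\<^esub> (a \<odot>\<^bsub>L\<^esub> x)"
proof -
  have "B +>\<^bsub>L\<^esub> (a \<odot>\<^bsub>L\<^esub> y) = B +>\<^bsub>L\<^esub> (a \<odot>\<^bsub>L\<^esub> x)" if "y \<in> B +>\<^bsub>L\<^esub> x" for y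
  proof -
    obtain b where b: "b \<in> B" "y = b \<oplus>\<^bsub>L\<^esub> x"
      using \<open>y \<in> B +>\<^bsub>L\<^esub> x\<close> unfolding mem_coset by blast
    have "a \<odot>\<^bsub>L\<^esub> y = a \<odot>\<^bsub>L\<^esub> b \<oplus>\<^bsub>L\<^esub> a \<odot>\<^bsub>L\<^esub> x"
      using b assms B_closed(2) by (simp add: smult_r_distr)
    then show ?thesis
      using coset_eqI[of "a \<odot>\<^bsub>L\<^esub> x" "a \<odot>\<^bsub>L\<^esub> b"] assms b(1) B_closed(5) by simp
  qed
  then have "(\<Union>y\<in>B +>\<^bsub>L\<^esub> x. B +>\<^bsub>L\<^esub> (a \<odot>\<^bsub>L\<^esub> y)) = B +>\<^bsub>L\<^esub> (a \<odot>\<^bsub>L\<^esub> x)"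
    by (intro UN_constant_eq[OF coset_self[OF assms(2)]] ballI)
  then show ?thesis
    by (simp add: lie_quotient_def)
qed

lemma quotient_mult:
  assumes x: "x \<in> carrier L" and y: "y \<in> carrier L"
  shows "(B +>\<^bsub>L\<^esub> x) \<otimes>\<^bsub>lie_quotient L B\<^esub> (B +>\<^bsub>L\<^esub> y) = B +>\<^bsub>L\<^esub> (x \<otimes>\<^bsub>L\<^esub> y)"
proof -
  have "B +>\<^bsub>L\<^esub> (x' \<otimes>\<^bsub>L\<^esub> y') = B +>\<^bsub>L\<^esub> (x \<otimes>\<^bsub>L\<^esub> y)"
    if x': "x' \<in> B +>\<^bsub>L\<^esub> x" and y': "y' \<in> B +>\<^bsub>L\<^esub> y" for x' y'
  proof -
    obtain b where b: "b \<in> B" "x' = b \<oplus>\<^bsub>L\<^esub> x"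
      using x' unfolding mem_coset by blast
    obtain c where c: "c \<in> B" "y' = c \<oplus>\<^bsub>L\<^esub> y"
      using y' unfolding mem_coset by blast
    note carr = x y B_closed(2)[OF b(1)] B_closed(2)[OF c(1)]
    let ?d = "b \<otimes>\<^bsub>L\<^esub> (c \<oplus>\<^bsub>L\<^esub> y) \<oplus>\<^bsub>L\<^esub> x \<otimes>\<^bsub>L\<^esub> c"
    have "x' \<otimes>\<^bsub>L\<^esub> y' = b \<otimes>\<^bsub>L\<^esub> (c \<oplus>\<^bsub>L\<^esub> y) \<oplus>\<^bsub>L\<^esub> x \<otimes>\<^bsub>L\<^esub> (c \<oplus>\<^bsub>L\<^esub> y)"
      using carr unfolding b(2) c(2) by (intro bracket_add_left) auto
    also have "\<dots> = ?d \<oplus>\<^bsub>L\<^esub> x \<otimes>\<^bsub>L\<^esub> y"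
      using carr by (simp add: bracket_add_right bracket_closed M.a_assoc)
    finally have eq: "x' \<otimes>\<^bsub>L\<^esub> y' = ?d \<oplus>\<^bsub>L\<^esub> x \<otimes>\<^bsub>L\<^esub> y" .
    have "?d \<in> B"
      using carr b(1) c(1) by (intro B_closed(4) B_bracket) auto
    then show ?thesis
      unfolding eq by (intro coset_eqI bracket_closed x y)
  qed
  then have "(\<Union>x'\<in>B +>\<^bsub>L\<^esub> x. \<Union>y'\<in>B +>\<^bsub>L\<^esub> y. B +>\<^bsub>L\<^esub> (x' \<otimes>\<^bsub>L\<^esub> y')) = B +>\<^bsub>L\<^esub> (x \<otimes>\<^bsub>L\<^esub> y)"
    by (intro UN_constant_eq[OF coset_self[OF x]] UN_constant_eq[OF coset_self[OF y]] ballI)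
  then show ?thesis
    by (simp add: lie_quotient_def rcoset_mult_def)
qed

lemma coset_in_quotient: "x \<in> carrier L \<Longrightarrow> B +>\<^bsub>L\<^esub> x \<in> carrier (lie_quotient L B)"
  by (simp add: quotient_carrier)

lemma quotient_carrierE:
  assumes "X \<in> carrier (lie_quotient L B)"
  obtains x where "x \<in> carrier L" "X = B +>\<^bsub>L\<^esub> x"
  using assms by (auto simp: quotient_carrier)

lemmas quotient_simps =
  coset_in_quotient quotient_zero quotient_add quotient_smult quotient_mult

lemma quotient_lie_algebra: "lie_algebra F (lie_quotient L B)"
proof (intro lie_algebra.intro vectorspace.intro lie_algebra_axioms.intro)
  show "module F (lie_quotient L B)"
  proof (rule module_criteria)
    show "cring F"
      by (rule R.cring_axioms)
    show "\<forall>v\<in>carrier (lie_quotient L B). \<exists>w\<in>carrier (lie_quotient L B).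
        v \<oplus>\<^bsub>lie_quotient L B\<^esub> w = \<zero>\<^bsub>lie_quotient L B\<^esub>"
    proof
      fix v assume "v \<in> carrier (lie_quotient L B)"
      then obtain x where x: "x \<in> carrier L" "v = B +>\<^bsub>L\<^esub> x"
        by (rule quotient_carrierE)
      then have "v \<oplus>\<^bsub>lie_quotient L B\<^esub> (B +>\<^bsub>L\<^esub> (\<ominus>\<^bsub>L\<^esub> x)) = \<zero>\<^bsub>lie_quotient L B\<^esub>"
        by (simp add: quotient_simps M.r_neg)
      moreover have "B +>\<^bsub>L\<^esub> (\<ominus>\<^bsub>L\<^esub> x) \<in> carrier (lie_quotient L B)"
        using x by (simp add: coset_in_quotient)
      ultimately show "\<exists>w\<in>carrier (lie_quotient L B).
          v \<oplus>\<^bsub>lie_quotient L B\<^esub> w = \<zero>\<^bsub>lie_quotient L B\<^esub>"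
        by (rule bexI)
    qed
  qed (safe elim!: quotient_carrierE,
      simp_all add: quotient_simps smult_l_distr smult_r_distr smult_assoc1 M.a_ac)
  show "field F"
    by (rule field_axioms)
qed (elim quotient_carrierE; simp add: quotient_simps bracket_closed bracket_add_left
    bracket_add_right bracket_smult_left bracket_smult_right bracket_self jacobi)+

lemma quotient_ad_pow:
  assumes x: "x \<in> carrier L" and y: "y \<in> carrier L"
  shows "(lie_ad (lie_quotient L B) (B +>\<^bsub>L\<^esub> x) ^^ n) (B +>\<^bsub>L\<^esub> y) = B +>\<^bsub>L\<^esub> ((lie_ad L x ^^ n) y)"
proof (induction n)
  case (Suc n)
  define z where "z = (lie_ad L x ^^ n) y"
  have z: "z \<in> carrier L" "(lie_ad L x ^^ Suc n) y = x \<otimes>\<^bsub>L\<^esub> z"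
    unfolding z_def by (rule ad_pow_closed[OF x y], simp add: lie_ad_def)
  have "(lie_ad (lie_quotient L B) (B +>\<^bsub>L\<^esub> x) ^^ Suc n) (B +>\<^bsub>L\<^esub> y) =
      lie_ad (lie_quotient L B) (B +>\<^bsub>L\<^esub> x) (B +>\<^bsub>L\<^esub> z)"
    by (simp add: Suc z_def)
  also have "\<dots> = B +>\<^bsub>L\<^esub> (x \<otimes>\<^bsub>L\<^esub> z)"
    using quotient_mult[OF x z(1)] by (simp add: lie_ad_def)
  finally show ?case
    by (simp only: z(2))
qed simp

text \<open>The last term of the lower central series of the quotient is zero and contains the image of a
  power of every adjoint map; upstairs this says that the power maps into \<open>B\<close>.\<close>

lemma quotient_nilpotent_ad_pow:
  assumes "lie_nilpotent F (lie_quotient L B)"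
  obtains n where "\<And>x y. x \<in> carrier L \<Longrightarrow> y \<in> carrier L \<Longrightarrow> (lie_ad L x ^^ n) y \<in> B"
proof -
  interpret Q: lie_algebra F "lie_quotient L B"
    by (rule quotient_lie_algebra)
  obtain n where n: "lower_central_series F (lie_quotient L B) n = {\<zero>\<^bsub>lie_quotient L B\<^esub>}"
    using assms by (auto simp: lie_nilpotent_def)
  show thesis
  proof (rule that)
    fix x y assume x: "x \<in> carrier L" and y: "y \<in> carrier L"
    have "B +>\<^bsub>L\<^esub> ((lie_ad L x ^^ n) y) = \<zero>\<^bsub>lie_quotient L B\<^esub>"
      using Q.ad_pow_in_lower_central_series[of "B +>\<^bsub>L\<^esub> x" "B +>\<^bsub>L\<^esub> y" n] x y n
      by (simp add: quotient_ad_pow quotient_carrier)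
    then have "B +>\<^bsub>L\<^esub> ((lie_ad L x ^^ n) y) = B"
      by (simp add: lie_quotient_def)
    then show "(lie_ad L x ^^ n) y \<in> B"
      using coset_self[OF ad_pow_closed[OF x y]] by blast
  qed
qed

end

context lie_algebra
begin

text \<open>\<open>L / L\<close> is zero, so already the first term of its lower central series vanishes.\<close>

lemma quotient_whole_nilpotent: "lie_nilpotent F (lie_quotient L (carrier L))"
proof -
  interpret lie_algebra_ideal F L "carrier L"
    by unfold_locales (rule ideal_whole)
  have "carrier (lie_quotient L (carrier L)) = {\<zero>\<^bsub>lie_quotient L (carrier L)\<^esub>}"
    using coset_eqI[of "\<zero>\<^bsub>L\<^esub>"] unfolding quotient_carrier quotient_zero by auto
  then show ?thesis
    unfolding lie_nilpotent_def by (intro exI[of _ 0]) simp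
qed

lemma sum_ideal:
  assumes I: "lie_ideal F I L" and J: "lie_ideal F J L"
  shows "lie_ideal F (subspace_sum I J) L"
  unfolding lie_ideal_def
proof (intro conjI ballI)
  note Is = ideal_subspace[OF I] and Js = ideal_subspace[OF J]
  show "subspace F (subspace_sum I J) L"
    by (rule sum_is_subspace[OF Is Js])
  fix x y assume "x \<in> subspace_sum I J" and y: "y \<in> carrier L"
  then obtain i j where ij: "i \<in> I" "j \<in> J" "x = i \<oplus>\<^bsub>L\<^esub> j"
    by (auto simp: submodule_sum_def)
  then have "x \<otimes>\<^bsub>L\<^esub> y = i \<otimes>\<^bsub>L\<^esub> y \<oplus>\<^bsub>L\<^esub> j \<otimes>\<^bsub>L\<^esub> y"
    using subspace_carrier[OF Is] subspace_carrier[OF Js] y by (simp add: bracket_add_left)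
  then show "x \<otimes>\<^bsub>L\<^esub> y \<in> subspace_sum I J"
    using ideal_bracket(1)[OF I ij(1) y] ideal_bracket(1)[OF J ij(2) y]
    by (force simp: submodule_sum_def)
qed

text \<open>An ideal that is maximal among those inside \<open>U\<close> contains all of them, since the sum of two such
  ideals is another one. So the largest ideal inside \<open>U\<close> exists.\<close>

lemma lie_core_greatest:
  assumes fd: "fin_dim" and U: "subspace F U L"
  shows lie_core_ideal: "lie_ideal F (lie_core F U L) L"
    and lie_core_subset: "lie_core F U L \<subseteq> U"
    and lie_core_upper: "\<And>I. lie_ideal F I L \<Longrightarrow> I \<subseteq> U \<Longrightarrow> I \<subseteq> lie_core F U L"
proof -
  have sub: "subspace F I L" if "lie_ideal F I L \<and> I \<subseteq> U" for I
    using that by (simp add: lie_ideal_def)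
  have triv: "lie_ideal F {\<zero>\<^bsub>L\<^esub>} L \<and> {\<zero>\<^bsub>L\<^esub>} \<subseteq> U"
    using ideal_trivial subspace_zero[OF U] by simp
  obtain C where C: "lie_ideal F C L \<and> C \<subseteq> U"
    and max: "\<And>I. lie_ideal F I L \<and> I \<subseteq> U \<Longrightarrow> C \<subseteq> I \<Longrightarrow> I = C"
    using maximal_subspace_exists[OF fd, of "\<lambda>I. lie_ideal F I L \<and> I \<subseteq> U", OF sub triv] by metis
  note Cs = ideal_subspace[OF conjunct1[OF C]]
  have upper: "I \<subseteq> C" if I: "lie_ideal F I L \<and> I \<subseteq> U" for I
  proof -
    note Is = ideal_subspace[OF conjunct1[OF I]]
    have "subspace_sum C I \<subseteq> U"
      using vsum_is_minimal[OF Cs Is U] C I by blast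
    then have "subspace_sum C I = C"
      using max[of "subspace_sum C I"] sum_ideal C I in_sum_vs[OF Cs Is] by metis
    then show ?thesis
      using vsum_is_minimal[OF Cs Is Cs] by simp
  qed
  have core: "lie_core F U L = C"
    unfolding lie_core_def using C upper by (rule Greatest_equality)
  show "lie_ideal F (lie_core F U L) L" "lie_core F U L \<subseteq> U"
    using C by (simp_all add: core)
  show "I \<subseteq> lie_core F U L" if "lie_ideal F I L" "I \<subseteq> U" for I
    using upper that by (simp add: core)
qed

section \<open>Maximal subalgebras above Engel subalgebras\<close>

lemma engel_maximal_setD:
  assumes "M \<in> engel_maximal_set F L"
  shows "subspace F M L" "M \<noteq> carrier L"
  using assms by (auto simp: engel_maximal_set_def maximal_lie_subalgebra_def lie_subalgebra_def)

lemma engel_subalgebra_in_maximal: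
  assumes fd: "fin_dim" and x: "x \<in> carrier L" and proper: "engel_subalgebra L x \<noteq> carrier L"
  obtains M where "M \<in> engel_maximal_set F L" "engel_subalgebra L x \<subseteq> M"
proof -
  have sub: "subspace F U L" if "lie_subalgebra F U L \<and> U \<noteq> carrier L" for U
    using that by (simp add: lie_subalgebra_def)
  have E: "lie_subalgebra F (engel_subalgebra L x) L \<and> engel_subalgebra L x \<noteq> carrier L"
    using engel_subalgebra_subalgebra[OF x] proper by simp
  obtain M where M: "lie_subalgebra F M L \<and> M \<noteq> carrier L" "engel_subalgebra L x \<subseteq> M"
    "\<And>U. lie_subalgebra F U L \<and> U \<noteq> carrier L \<Longrightarrow> M \<subseteq> U \<Longrightarrow> U = M"
    using maximal_subspace_exists[OF fd, of "\<lambda>U. lie_subalgebra F U L \<and> U \<noteq> carrier L", OF sub E]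
    by metis
  have "maximal_lie_subalgebra F M L"
    unfolding maximal_lie_subalgebra_def using M(1) M(3) by simp
  then have "M \<in> engel_maximal_set F L"
    unfolding engel_maximal_set_def using M(2) x by blast
  then show thesis
    using that M(2) by simp
qed

text \<open>Otherwise the Engel subalgebra lies in some \<open>M\<close> of the family, which also contains \<open>B\<close> and thus
  the image of a power of \<open>ad x\<close>; by the Fitting decomposition \<open>M\<close> would be all of \<open>L\<close>.\<close>

lemma engel_subalgebra_full:
  assumes fd: "fin_dim" and x: "x \<in> carrier L" and B: "B \<subseteq> engel_frattini F L"
    and im: "\<And>y. y \<in> carrier L \<Longrightarrow> (lie_ad L x ^^ n) y \<in> B"
  shows "engel_subalgebra L x = carrier L"
proof (rule ccontr)
  assume "engel_subalgebra L x \<noteq> carrier L"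
  then obtain M where M: "M \<in> engel_maximal_set F L" "engel_subalgebra L x \<subseteq> M"
    by (rule engel_subalgebra_in_maximal[OF fd x])
  have "B \<subseteq> M"
    using B M(1) by (auto simp: engel_frattini_def split: if_splits)
  then have "M = carrier L"
    by (intro engel_subalgebra_supplement[OF fd x engel_maximal_setD(1)[OF M(1)] M(2)])
      (use im in blast)
  then show False
    using engel_maximal_setD(2)[OF M(1)] by simp
qed

lemma engel_frattini_subspace: "subspace F (engel_frattini F L) L"
  using subspace_Inter[OF _ engel_maximal_setD(1)]
  by (simp add: engel_frattini_def subspace_whole)

lemma engel_maximal_set_empty_iff_nilpotent:
  assumes fd: "fin_dim"
  shows "lie_nilpotent F L \<longleftrightarrow> engel_maximal_set F L = {}"
proof
  assume nil: "lie_nilpotent F L"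
  have False if M: "M \<in> engel_maximal_set F L" for M
  proof -
    obtain x where x: "x \<in> carrier L" "engel_subalgebra L x \<subseteq> M"
      using M by (auto simp: engel_maximal_set_def)
    then have "M = carrier L"
      using nilpotent_engel_subalgebra[OF nil x(1)] subspace_subset[OF engel_maximal_setD(1)[OF M]]
      by simp
    then show False
      using engel_maximal_setD(2)[OF M] by simp
  qed
  then show "engel_maximal_set F L = {}"
    by auto
next
  assume empty: "engel_maximal_set F L = {}"
  show "lie_nilpotent F L"
  proof (rule engel[OF fd])
    fix x assume "x \<in> carrier L"
    then show "engel_subalgebra L x = carrier L"
      using engel_subalgebra_in_maximal[OF fd] empty by (metis empty_iff)
  qed
qed

text \<open>An ideal \<open>M\<close> above the Engel subalgebra of \<open>x\<close> contains \<open>x\<close> itself, hence the image of \<open>ad x\<close>,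
  and cannot be proper.\<close>

lemma no_engel_maximal_ideal:
  assumes fd: "fin_dim" and M: "M \<in> engel_maximal_set F L"
  shows "\<not> lie_ideal F M L"
proof
  assume I: "lie_ideal F M L"
  obtain x where x: "x \<in> carrier L" "engel_subalgebra L x \<subseteq> M"
    using M by (auto simp: engel_maximal_set_def)
  have "(lie_ad L x ^^ 1) y \<in> M" if "y \<in> carrier L" for y
    using ideal_bracket(1)[OF I _ that] mem_engel_subalgebra[OF x(1)] x(2) by (auto simp: lie_ad_def)
  then have "M = carrier L"
    by (rule engel_subalgebra_supplement[OF fd x(1) engel_maximal_setD(1)[OF M] x(2)])
  then show False
    using engel_maximal_setD(2)[OF M] by simp
qed

end

section \<open>Nilpotency and the core of the intersection\<close>

theorem lemma2p3:
  fixes F :: "('a, 'm) ring_scheme" and L :: "('a, 'b, 'n) module_scheme"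
  assumes "lie_algebra F L"
    and "vectorspace.fin_dim F L"
  shows "(nil_on (engel_frattini_core F L) L \<and>
            lie_nilpotent F (L\<lparr>carrier := engel_frattini_core F L\<rparr>)) \<and>
         (lie_nilpotent F L \<longleftrightarrow> carrier L = engel_frattini_core F L) \<and>
         (lie_nilpotent F L \<longleftrightarrow> engel_maximal_set F L = {}) \<and>
         (lie_nilpotent F L \<longleftrightarrow> (\<forall>M\<in>engel_maximal_set F L. lie_ideal F M L)) \<and>
         (lie_nilpotent F L \<longleftrightarrow>
            (\<exists>B. lie_ideal F B L \<and> B \<subseteq> engel_frattini_core F L \<and>
                 lie_nilpotent F (lie_quotient L B)))"
proof -
  interpret lie_algebra F L
    by (rule assms(1))
  note fd = assms(2)
  define C where "C = engel_frattini_core F L"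
  note core = lie_core_greatest[OF fd engel_frattini_subspace, folded engel_frattini_core_def C_def]
  note Cs = ideal_subspace[OF core(1)]
  have C_engel: "engel_subalgebra L x = carrier L" if x: "x \<in> C" for x
  proof (rule engel_subalgebra_full[OF fd subspace_carrier[OF Cs x] core(2)])
    show "(lie_ad L x ^^ 1) y \<in> C" if "y \<in> carrier L" for y
      using ideal_bracket(1)[OF core(1) x that] by (simp add: lie_ad_def)
  qed
  have nil: "nil_on C L"
    unfolding nil_on_def
  proof
    fix x assume x: "x \<in> C"
    obtain n where "\<And>y. y \<in> carrier L \<Longrightarrow> (lie_ad L x ^^ n) y = \<zero>\<^bsub>L\<^esub>"
      using ad_pow_uniformly_vanishes[OF fd subspace_carrier[OF Cs x] C_engel[OF x]] by metis
    then show "\<exists>n. \<forall>y\<in>carrier L. (lie_ad L x ^^ n) y = \<zero>\<^bsub>L\<^esub>"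
      by blast
  qed
  have C_nilpotent: "lie_nilpotent F (L\<lparr>carrier := C\<rparr>)"
    by (rule nil_subalgebra_nilpotent[OF fd ideal_subalgebra[OF core(1)] C_engel])
  note empty_iff = engel_maximal_set_empty_iff_nilpotent[OF fd]
  have whole: "carrier L = C" if "lie_nilpotent F L"
  proof -
    have "engel_frattini F L = carrier L"
      using that empty_iff by (simp add: engel_frattini_def)
    then show ?thesis
      using core(3)[OF ideal_whole] subspace_subset[OF Cs] by simp
  qed
  have core_iff: "lie_nilpotent F L \<longleftrightarrow> carrier L = C"
  proof
    assume "carrier L = C"
    then show "lie_nilpotent F L"
      using engel[OF fd C_engel] by simp
  qed (rule whole)
  have ideal_iff: "lie_nilpotent F L \<longleftrightarrow> (\<forall>M\<in>engel_maximal_set F L. lie_ideal F M L)"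
    using empty_iff no_engel_maximal_ideal[OF fd] by auto
  have "lie_nilpotent F L"
    if B: "lie_ideal F B L" "B \<subseteq> C" "lie_nilpotent F (lie_quotient L B)" for B
  proof -
    interpret lie_algebra_ideal F L B
      by unfold_locales (rule B(1))
    obtain n where n: "\<And>x y. x \<in> carrier L \<Longrightarrow> y \<in> carrier L \<Longrightarrow> (lie_ad L x ^^ n) y \<in> B"
      using quotient_nilpotent_ad_pow[OF B(3)] by metis
    show ?thesis
      by (rule engel[OF fd engel_subalgebra_full[OF fd _ subset_trans[OF B(2) core(2)] n]])
  qed
  \<comment> \<open>For nilpotent \<open>L\<close> the core is \<open>L\<close>, so \<open>B = L\<close> is admissible.\<close>
  moreover have "\<exists>B. lie_ideal F B L \<and> B \<subseteq> C \<and> lie_nilpotent F (lie_quotient L B)"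
    if "lie_nilpotent F L"
    using whole[OF that] ideal_whole quotient_whole_nilpotent by (intro exI[of _ "carrier L"]) simp
  ultimately have quotient_iff: "lie_nilpotent F L \<longleftrightarrow>
      (\<exists>B. lie_ideal F B L \<and> B \<subseteq> C \<and> lie_nilpotent F (lie_quotient L B))"
    by blast
  show ?thesis
    unfolding C_def[symmetric]
    by (intro conjI nil C_nilpotent core_iff empty_iff ideal_iff quotient_iff)
qed

end
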